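(* Let $p>2$ be a prime, and let $f(x)\in \mathbb{F}_p[x]$ be a polynomial that factors as $f(x)=f_1(x)f_2(x)\cdots f_k(x)$ with $k\geq 1$, where $f_1(x),\ldots,f_k(x)\in\mathbb{F}_p[x]$ are irreducible and pairwise non-associated. Let $\mathcal{S}_{f(x)}^p$ denote the multiplicative semigroup of the quotient ring $\frac{\mathbb{F}_p[x]}{\langle f(x)\rangle}$, and let $U(\mathcal{S}_{f(x)}^p)$ denote its group of units. Then $$D(\mathcal{S}_{f(x)}^p)=D(U(\mathcal{S}_{f(x)}^p)),$$ where $D$ denotes the Davenport constant.
   Context: $\mathbb{F}_p$ is the prime field with $p$ elements. The multiplicative semigroup of a ring $R$ consists of all elements of $R$ (including $0$) under multiplication; it is a commutative semigroup with identity when $R$ is commutative with $1$. For a commutative semigroup $\mathcal{S}$ (operation written $+$) with identity $0_{\mathcal{S}}$, $U(\mathcal{S})=\{a\in\mathcal{S}: a+a'=0_{\mathcal{S}}\text{ for some }a'\in\mathcal{S}\}$ is its group of units. A sequence over a finite commutative semigroup $\mathcal{S}$ is a finite unordered sequence of elements of $\mathcal{S}$ with repetition allowed (i.e. a finite multiset); its length is the number of terms counted with multiplicity. A subsequence is a sub-multiset; a subsequence $T'$ of $T$ is proper if $T'\neq T$. $\sigma(T)$ denotes the sum (in the semigroup operation) of all terms of $T$. If $\mathcal{S}$ has an identity $0_{\mathcal{S}}$, the empty sequence is allowed, and its sum is by convention $0_{\mathcal{S}}$. A sequence $T$ is reducible if it contains a proper subsequence $T'$ (possibly empty, when $\mathcal{S}$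 has an identity) with $\sigma(T')=\sigma(T)$. The Davenport constant $D(\mathcal{S})$ of a finite commutative semigroup $\mathcal{S}$ is the smallest positive integer $d$ such that every sequence over $\mathcal{S}$ of length at least $d$ is reducible. For a finite abelian group $G$, this is the usual Davenport constant: the smallest $d$ such that every sequence of $d$ elements of $G$ contains a nonempty subsequence whose sum is the identity. *)

theory Defs
  imports
    "HOL-Library.Multiset"
    "HOL-Algebra.Polynomial_Divisibility"
    "HOL-Number_Theory.Residues"
begin

text \<open>
  Semigroups with identity are HOL-Algebra monoids, written multiplicatively; so the ``sum''
  \<open>\<sigma>(T)\<close> of a sequence \<open>T\<close> is a product. Each distinct term \<open>a\<close> of \<open>T\<close> contributes its power
  with exponent the multiplicity of \<open>a\<close> in \<open>T\<close>.
\<close>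

definition seq_sum :: "('a, 'b) monoid_scheme \<Rightarrow> 'a multiset \<Rightarrow> 'a" where
  "seq_sum S T = (\<Otimes>\<^bsub>S\<^esub>a\<in>set_mset T. a [^]\<^bsub>S\<^esub> count T a)"

definition reducible_seq :: "('a, 'b) monoid_scheme \<Rightarrow> 'a multiset \<Rightarrow> bool" where
  "reducible_seq S T \<longleftrightarrow> (\<exists>T'. T' \<subset># T \<and> seq_sum S T' = seq_sum S T)"

text \<open>
  Intended for finite commutative monoids. There the \<open>LEAST\<close> is attained: in a sequence of length
  at least \<open>|S|\<close> two of the partial products (the empty one included) agree.
\<close>

definition davenport :: "('a, 'b) monoid_scheme \<Rightarrow> nat" where
  "davenport S = (LEAST d. 0 < d \<and>
     (\<forall>T. set_mset T \<subseteq> carrier S \<and> d \<le> size T \<longrightarrow> reducible_seq S T))"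

abbreviation Fp_poly :: "nat \<Rightarrow> int list ring" where
  "Fp_poly p \<equiv> poly_ring (residue_ring (int p))"

text \<open>
  A HOL-Algebra ring record extends a monoid record by \<open>zero\<close> and \<open>add\<close>; used as a monoid, the
  quotient ring below is its multiplicative semigroup on the full carrier, \<open>0\<close> included.
\<close>

definition poly_semigroup :: "nat \<Rightarrow> int list \<Rightarrow> int list set ring" where
  "poly_semigroup p f = Fp_poly p Quot (PIdl\<^bsub>Fp_poly p\<^esub> f)"

lemma (in comm_monoid) seq_sum_empty: "seq_sum G {#} = \<one>"
  by (simp add: seq_sum_def)

lemma (in comm_monoid) seq_sum_add_mset:
  assumes T: "set_mset T \<subseteq> carrier G" and a: "a \<in> carrier G"
  shows "seq_sum G (add_mset a T) = a \<otimes> seq_sum G T"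
proof -
  let ?A = "set_mset T - {a}" and ?f = "\<lambda>T x. x [^] count T x"
  have split: "seq_sum G U = ?f U a \<otimes> finprod G (?f U) ?A"
    if "set_mset U = insert a ?A" for U
    unfolding seq_sum_def that using T a by (subst finprod_insert) auto
  have eq: "finprod G (?f (add_mset a T)) ?A = finprod G (?f T) ?A"
    using T by (intro finprod_cong') auto
  have cl: "finprod G (?f T) ?A \<in> carrier G"
    using T by (intro finprod_closed) auto
  have "seq_sum G (add_mset a T) = (a \<otimes> a [^] count T a) \<otimes> finprod G (?f T) ?A"
    using a eq by (subst split) (auto simp: nat_pow_Suc m_comm)
  also have "\<dots> = a \<otimes> (?f T a \<otimes> finprod G (?f T) ?A)"
    using a cl by (simp add: m_assoc)
  also have "?f T a \<otimes> finprod G (?f T) ?A = seq_sum G T"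
  proof (cases "a \<in># T")
    case True
    then show ?thesis by (subst split) auto
  next
    case False
    then have "?A = set_mset T" "count T a = 0" by (auto simp: not_in_iff)
    then show ?thesis using cl by (simp add: seq_sum_def)
  qed
  finally show ?thesis .
qed

end

theory Submission
  imports Defs
begin

text \<open>
  A finite reduced ring \<open>R\<close> satisfies \<open>x ^ (N + 1) = x\<close> for some \<open>N > 0\<close>, so \<open>x ^ N\<close> is the
  idempotent supported where \<open>x\<close> is invertible. Given a sequence \<open>t\<^sub>0, \<dots>, t\<^sub>n\<^sub>-\<^sub>1\<close> in \<open>R\<close>, let
  \<open>E\<^sub>j = (t\<^sub>0 \<cdots> t\<^sub>j\<^sub>-\<^sub>1) ^ N\<close>, a descending chain of idempotents. Replace \<open>t\<^sub>j\<close> by the unit that is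
  \<open>-1\<close> on \<open>E\<^sub>j - E\<^sub>j\<^sub>+\<^sub>1\<close> and \<open>1\<close> elsewhere if this difference is nonzero, and by the unit that is
  \<open>t\<^sub>j\<close> on \<open>E\<^sub>n\<close> and \<open>1\<close> elsewhere otherwise. If a subsequence of these units has product \<open>1\<close>, then it
  avoids the indices of the first kind because \<open>-1 \<noteq> 1\<close>, so the corresponding terms \<open>t\<^sub>j\<close> have
  product \<open>1\<close> on \<open>E\<^sub>n\<close>. They can be deleted: the remaining terms contain all those that shrink
  the support, so their product still lives on \<open>E\<^sub>n\<close>. Hence a bound for the group of units is a
  bound for \<open>R\<close>. Squarefreeness of \<open>f\<close> makes the quotient reduced, and \<open>p\<close> odd excludes
  \<open>2\<close>-torsion.
\<close>

subsection \<open>Reducibility and the Davenport constant\<close>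

text \<open>Enumerating the terms turns subsequences into subsets of an index set, where repeated
  terms stay distinct.\<close>

lemma mset_eq_image_mset_upto:
  obtains t :: "nat \<Rightarrow> 'a" where "T = image_mset t (mset_set {..<size T})"
proof -
  obtain xs where xs: "mset xs = T"
    using ex_mset by blast
  have "T = mset (map ((!) xs) [0..<length xs])"
    using xs by (simp add: map_nth)
  also have "\<dots> = image_mset ((!) xs) (mset_set {..<length xs})"
    by (simp add: lessThan_atLeast0)
  finally show thesis
    using that xs by (metis size_mset)
qed

lemma subset_mset_set_conv:
  assumes "finite A"
  shows "N \<subseteq># mset_set A \<longleftrightarrow> (\<exists>B\<subseteq>A. N = mset_set B)"
proof
  assume N: "N \<subseteq># mset_set A"
  have "count N x = count (mset_set (set_mset N)) x" for x
  proof -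
    have "count N x \<le> count (mset_set A) x"
      using N by (simp add: mset_subset_eq_count)
    also have "\<dots> \<le> 1"
      by (simp add: count_mset_set')
    finally have le: "count N x \<le> 1" .
    show ?thesis
    proof (cases "x \<in># N")
      case True
      then have "0 < count N x" by simp
      with le have "count N x = 1" by linarith
      with True show ?thesis by simp
    qed (simp add: not_in_iff)
  qed
  then have "N = mset_set (set_mset N)"
    by (intro multiset_eqI) simp
  moreover have "set_mset N \<subseteq> A"
    using set_mset_mono[OF N] assms by simp
  ultimately show "\<exists>B\<subseteq>A. N = mset_set B" by blast
next
  assume "\<exists>B\<subseteq>A. N = mset_set B"
  then show "N \<subseteq># mset_set A"
    using assms by (auto intro: subset_imp_msubset_mset_set)
qed

section \<open>Products over index sets, and the Davenport constant of a finite monoid\<close>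

context comm_monoid
begin

lemma seq_sum_image_mset:
  assumes "finite A" and "t \<in> A \<rightarrow> carrier G"
  shows "seq_sum G (image_mset t (mset_set A)) = finprod G t A"
  using assms
proof (induction A rule: finite_induct)
  case empty
  then show ?case by (simp add: seq_sum_empty)
next
  case (insert x A)
  then have "set_mset (image_mset t (mset_set A)) \<subseteq> carrier G" by auto
  with insert show ?case by (simp add: seq_sum_add_mset)
qed

text \<open>Submultisets of an image lift to index subsets, and sizes detect properness even when
  \<open>t\<close> repeats values.\<close>

lemma reducible_seq_image_mset_iff:
  assumes A: "finite A" and t: "t \<in> A \<rightarrow> carrier G"
  shows "reducible_seq G (image_mset t (mset_set A))
    \<longleftrightarrow> (\<exists>B\<subset>A. finprod G t B = finprod G t A)"
proof -
  have sum: "seq_sum G (image_mset t (mset_set B)) = finprod G t B" if "B \<subseteq> A" for B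
    using that A t by (intro seq_sum_image_mset) (auto intro: finite_subset)
  have sub: "image_mset t (mset_set B) \<subset># image_mset t (mset_set A) \<longleftrightarrow> B \<subset> A" if B: "B \<subseteq> A" for B
  proof -
    have "image_mset t (mset_set B) \<subseteq># image_mset t (mset_set A)"
      using A B by (intro image_mset_subseteq_mono subset_imp_msubset_mset_set)
    moreover have "B = A" if "image_mset t (mset_set B) = image_mset t (mset_set A)"
    proof -
      from that have "size (image_mset t (mset_set B)) = size (image_mset t (mset_set A))" by simp
      then show ?thesis using A B by (simp add: card_subset_eq)
    qed
    ultimately show ?thesis using B by (auto simp: subset_mset.less_le)
  qed
  have img: "\<exists>B\<subseteq>A. T' = image_mset t (mset_set B)" if "T' \<subseteq># image_mset t (mset_set A)" for T'
  proof -
    have "T' + (image_mset t (mset_set A) - T') = image_mset t (mset_set A)"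
      using that by simp
    then obtain N N' where "mset_set A = N + N'" "T' = image_mset t N"
      by (metis image_mset_eq_plusD)
    then show ?thesis
      using subset_mset_set_conv[OF A, of N] by auto
  qed
  show ?thesis
    unfolding reducible_seq_def using img sum sub
    by (metis subset_mset.less_imp_le psubset_imp_subset order_refl)
qed

text \<open>Makes the \<open>LEAST\<close> usable. The cardinality of the monoid is a valid bound: a
  sequence at least that long has more prefix products, the empty one included, than there are
  elements, so two agree.\<close>

lemma davenport_property:
  assumes fin: "finite (carrier G)"
  shows "0 < davenport G"
    and "set_mset T \<subseteq> carrier G \<Longrightarrow> davenport G \<le> size T \<Longrightarrow> reducible_seq G T"
proof -
  let ?P = "\<lambda>d. 0 < d \<and> (\<forall>T. set_mset T \<subseteq> carrier G \<and> d \<le> size T \<longrightarrow> reducible_seq G T)"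
  have red: "reducible_seq G T"
    if T: "set_mset T \<subseteq> carrier G" "card (carrier G) \<le> size T" for T
  proof -
    obtain t where t: "T = image_mset t (mset_set {..<size T})"
      by (rule mset_eq_image_mset_upto)
    let ?n = "size T"
    have "set_mset T = t ` {..<?n}"
      by (subst t) simp
    then have tc: "t \<in> {..<?n} \<rightarrow> carrier G"
      using T by auto
    let ?F = "\<lambda>j. finprod G t {..<j}"
    have "?F ` {..?n} \<subseteq> carrier G"
      using tc by (auto intro!: finprod_closed)
    then have "card (?F ` {..?n}) \<le> card (carrier G)"
      using fin by (rule card_mono[rotated])
    also have "\<dots> < card {..?n}"
      using T by simp
    finally have "\<not> inj_on ?F {..?n}"
      by (rule pigeonhole)
    then obtain i j where ij: "i < j" "j \<le> ?n" "?F i = ?F j"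
      unfolding inj_on_def by (metis atMost_iff linorder_neqE_nat)
    \<comment> \<open>As \<open>?F i = ?F j\<close>, the indices from \<open>i\<close> to
      \<open>j - 1\<close> can be cut out; \<open>?C\<close> is the tail that is kept.\<close>
    let ?C = "{j..<?n}"
    have "finprod G t ({..<i} \<union> ?C) = ?F i \<otimes> finprod G t ?C"
      using ij tc by (intro finprod_Un_disjoint) auto
    also have "\<dots> = ?F j \<otimes> finprod G t ?C"
      using ij by simp
    also have "\<dots> = finprod G t ({..<j} \<union> ?C)"
      using ij tc by (intro finprod_Un_disjoint[symmetric]) auto
    also have "{..<j} \<union> ?C = {..<?n}"
      using ij by auto
    finally have "finprod G t ({..<i} \<union> ?C) = finprod G t {..<?n}" .
    moreover have "{..<i} \<union> ?C \<subseteq> {..<?n}" "i \<notin> {..<i} \<union> ?C" "i \<in> {..<?n}"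
      using ij by auto
    then have "{..<i} \<union> ?C \<subset> {..<?n}"
      by blast
    ultimately have "reducible_seq G (image_mset t (mset_set {..<?n}))"
      using tc by (subst reducible_seq_image_mset_iff) blast+
    then show ?thesis
      using t by simp
  qed
  have "0 < card (carrier G)"
    using fin by (auto simp: card_gt_0_iff)
  with red have "?P (card (carrier G))"
    by blast
  then have P: "?P (davenport G)"
    unfolding davenport_def by (rule LeastI)
  then show "0 < davenport G" by blast
  show "set_mset T \<subseteq> carrier G \<Longrightarrow> davenport G \<le> size T \<Longrightarrow> reducible_seq G T"
    using P by blast
qed

lemma davenport_le:
  assumes "0 < d"
    and "\<And>T. set_mset T \<subseteq> carrier G \<Longrightarrow> d \<le> size T \<Longrightarrow> reducible_seq G T"
  shows "davenport G \<le> d"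
  unfolding davenport_def using assms by (intro Least_le) blast

lemma seq_sum_units_of:
  assumes "set_mset T \<subseteq> Units G"
  shows "seq_sum (units_of G) T = seq_sum G T"
  using assms
proof (induction T)
  case empty
  then show ?case
    using comm_monoid.seq_sum_empty[OF comm_group.axioms(1)[OF units_comm_group]]
    by (simp add: seq_sum_empty units_of_one)
next
  case (add x T)
  then have "set_mset T \<subseteq> carrier G" "x \<in> carrier G" by auto
  with add show ?case
    using comm_monoid.seq_sum_add_mset[OF comm_group.axioms(1)[OF units_comm_group], of T x]
    by (simp add: seq_sum_add_mset units_of_carrier units_of_mult)
qed

lemma reducible_seq_units_of_iff:
  assumes "set_mset T \<subseteq> Units G"
  shows "reducible_seq (units_of G) T \<longleftrightarrow> reducible_seq G T"
proof -
  have "seq_sum (units_of G) T' = seq_sum G T'" if "T' \<subset># T" for T'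
    using that assms by (intro seq_sum_units_of) (meson order_trans set_mset_mono subset_mset.less_imp_le)
  then show ?thesis
    unfolding reducible_seq_def using seq_sum_units_of[OF assms] by metis
qed

text \<open>The easy inequality: subsequences of a sequence of units consist of units, so
  reducibility means the same in both monoids.\<close>

lemma davenport_units_of_le:
  assumes "finite (carrier G)"
  shows "davenport (units_of G) \<le> davenport G"
proof (rule comm_monoid.davenport_le)
  show "comm_monoid (units_of G)"
    using units_comm_group by (rule comm_group.axioms(1))
  show "0 < davenport G"
    using assms by (rule davenport_property)
next
  fix T assume T: "set_mset T \<subseteq> carrier (units_of G)" "davenport G \<le> size T"
  then have "set_mset T \<subseteq> Units G"
    by (simp add: units_of_carrier)
  then show "reducible_seq (units_of G) T"
    using T assms davenport_property(2)[of T] by (subst reducible_seq_units_of_iff) auto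
qed

end

subsection \<open>Finite reduced rings without \<open>2\<close>-torsion\<close>

context cring
begin

text \<open>By pigeonhole \<open>x^i = x^(i+m)\<close>, so \<open>x (1 - x^m)\<close> is nilpotent,
  hence zero. The period \<open>m\<close> depends on \<open>x\<close> but is at most the size of the
  ring, so the factorial of that size is a multiple of every period.\<close>

lemma finite_reduced_uniform_exponent:
  assumes fin: "finite (carrier R)"
    and reduced: "\<And>x n. x \<in> carrier R \<Longrightarrow> x [^] (n::nat) = \<zero> \<Longrightarrow> x = \<zero>"
  shows "\<exists>N::nat. 0 < N \<and> (\<forall>x\<in>carrier R. x [^] N \<otimes> x = x)"
proof -
  let ?c = "card (carrier R)"
  have "x [^] (fact ?c :: nat) \<otimes> x = x" if x: "x \<in> carrier R" for x
  proof -
    let ?F = "\<lambda>i::nat. x [^] i"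
    have "?F ` {..?c} \<subseteq> carrier R"
      using x by auto
    then have "card (?F ` {..?c}) \<le> ?c"
      using fin by (rule card_mono[rotated])
    also have "\<dots> < card {..?c}"
      by simp
    finally have "\<not> inj_on ?F {..?c}"
      by (rule pigeonhole)
    then obtain i j where ij: "i < j" "j \<le> ?c" "x [^] i = x [^] j"
      unfolding inj_on_def by (metis atMost_iff linorder_neqE_nat)
    define m where "m = j - i"
    have m: "0 < m" "m \<le> ?c"
      using ij by (auto simp: m_def)
    have "x [^] i \<otimes> x [^] m = x [^] j"
      using ij(1) x by (simp add: nat_pow_mult m_def)
    then have cyc: "x [^] i \<otimes> x [^] m = x [^] i"
      using ij(3) by simp
    have "x [^] i \<in> carrier R" "x [^] m \<in> carrier R"
      using x by auto
    then have "x [^] i \<otimes> (\<one> \<ominus> x [^] m) = x [^] i \<ominus> x [^] i \<otimes> x [^] m"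
      by algebra
    then have 0: "x [^] i \<otimes> (\<one> \<ominus> x [^] m) = \<zero>"
      using x by (simp add: cyc)
    \<comment> \<open>The exponent \<open>Suc i\<close> leaves a factor \<open>1 - x^m\<close> to
      pair with \<open>x^i\<close> even if \<open>i = 0\<close>.\<close>
    have "(x \<otimes> (\<one> \<ominus> x [^] m)) [^] Suc i
        = (x [^] i \<otimes> (\<one> \<ominus> x [^] m)) \<otimes> (x \<otimes> (\<one> \<ominus> x [^] m) [^] i)"
      using x by (simp add: nat_pow_distrib m_ac)
    also have "\<dots> = \<zero>"
      using x by (simp add: 0)
    finally have "(x \<otimes> (\<one> \<ominus> x [^] m)) [^] Suc i = \<zero>" .
    then have "x \<otimes> (\<one> \<ominus> x [^] m) = \<zero>"
      using x by (elim reduced[rotated]) auto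
    then have "x \<ominus> x [^] m \<otimes> x = \<zero>"
      using x by (simp add: r_distr a_minus_def r_minus m_comm)
    then have per: "x [^] m \<otimes> x = x"
      using x by simp
    have "x [^] (m * q) \<otimes> x = x" for q
    proof (induction q)
      case (Suc q)
      have "x [^] (m * Suc q) \<otimes> x = x [^] (m * q) \<otimes> (x [^] m \<otimes> x)"
        using x by (simp add: nat_pow_mult[symmetric] m_ac)
      then show ?case
        by (simp only: per Suc)
    qed (use x in simp)
    moreover have "m dvd fact ?c"
      using m by (intro dvd_fact) auto
    ultimately show ?thesis
      by (metis dvdE)
  qed
  then show ?thesis
    by (intro exI[of _ "fact ?c"]) simp
qed

text \<open>\<open>e\<close> is passed from factor to factor. With \<open>e\<close> idempotent, this
  compares two products on the component of \<open>e\<close> alone.\<close>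

lemma finprod_mult_cong:
  assumes "finite A" and "s \<in> A \<rightarrow> carrier R" and "t \<in> A \<rightarrow> carrier R" and "e \<in> carrier R"
    and "\<And>i. i \<in> A \<Longrightarrow> e \<otimes> s i = e \<otimes> t i"
  shows "e \<otimes> finprod R s A = e \<otimes> finprod R t A"
  using assms
proof (induction A rule: finite_induct)
  case (insert x A)
  have cl: "s x \<in> carrier R" "t x \<in> carrier R" "s \<in> A \<rightarrow> carrier R" "t \<in> A \<rightarrow> carrier R"
    using insert by auto
  then have *: "finprod R s A \<in> carrier R" "finprod R t A \<in> carrier R"
    by auto
  have "e \<otimes> finprod R s (insert x A) = s x \<otimes> (e \<otimes> finprod R s A)"
    using insert(1,2,6) cl * by (simp add: m_ac)
  also have "\<dots> = s x \<otimes> (e \<otimes> finprod R t A)"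
    using insert cl by simp
  also have "\<dots> = (e \<otimes> s x) \<otimes> finprod R t A"
    using insert(6) cl * by (simp add: m_ac)
  also have "\<dots> = (e \<otimes> t x) \<otimes> finprod R t A"
    using insert by simp
  also have "\<dots> = e \<otimes> finprod R t (insert x A)"
    using insert(1,2,6) cl * by (simp add: m_ac)
  finally show ?case .
qed simp

lemma finprod_mult_absorb:
  assumes "finite A" and "t \<in> A \<rightarrow> carrier R" and "e \<in> carrier R"
    and "\<And>i. i \<in> A \<Longrightarrow> e \<otimes> t i = e"
  shows "e \<otimes> finprod R t A = e"
  using finprod_mult_cong[of A t "\<lambda>_. \<one>" e] assms by simp

lemma finprod_Units:
  assumes "finite A" and "t \<in> A \<rightarrow> Units R"
  shows "finprod R t A \<in> Units R"
  using assms
proof (induction A rule: finite_induct)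
  case (insert x A)
  then have "t x \<in> carrier R" "t \<in> A \<rightarrow> carrier R"
    by auto
  with insert show ?case
    by (auto simp: Pi_def)
qed simp

text \<open>\<open>e a + (1 - e)\<close> is \<open>a\<close> on the component of \<open>e\<close>
  and \<open>1\<close> on the complement, and the product is taken componentwise. This supplies
  inverses for such patched elements.\<close>

lemma mult_idempotent_patch:
  assumes cl: "e \<in> carrier R" "a \<in> carrier R" "b \<in> carrier R"
    and e: "e \<otimes> e = e" and ab: "e \<otimes> (a \<otimes> b) = e"
  shows "(e \<otimes> a \<oplus> (\<one> \<ominus> e)) \<otimes> (e \<otimes> b \<oplus> (\<one> \<ominus> e)) = \<one>"
proof -
  define f where "f = \<one> \<ominus> e"
  have f: "f \<in> carrier R" using cl by (simp add: f_def)
  have ef: "e \<otimes> f = \<zero>"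
    using cl by (simp add: f_def a_minus_def r_distr r_minus e r_neg)
  have ff: "f \<otimes> f = f"
    using cl f ef by (subst f_def) (simp add: a_minus_def l_distr l_minus)
  have "(e \<otimes> a \<oplus> f) \<otimes> (e \<otimes> b \<oplus> f)
      = (e \<otimes> e) \<otimes> (a \<otimes> b) \<oplus> (e \<otimes> f) \<otimes> a \<oplus> (e \<otimes> f) \<otimes> b \<oplus> f \<otimes> f"
    using cl f by (simp add: l_distr r_distr m_ac a_ac)
  also have "\<dots> = e \<oplus> f"
    unfolding e ef ff ab using cl f by simp
  also have "\<dots> = \<one>"
    using cl unfolding f_def by algebra
  finally show ?thesis by (simp add: f_def)
qed

text \<open>The replacement by units keeps the index set, so a length that forces reducibility over
  the units does so over the whole ring.\<close>

lemma reducible_of_units_reducible: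
  fixes t :: "nat \<Rightarrow> 'a" and N n :: nat
  assumes N: "0 < N" and per: "\<And>x. x \<in> carrier R \<Longrightarrow> x [^] N \<otimes> x = x"
    and two: "\<And>x. x \<in> carrier R \<Longrightarrow> x \<oplus> x = \<zero> \<Longrightarrow> x = \<zero>"
    and t: "t \<in> {..<n} \<rightarrow> carrier R"
    and units: "\<And>h. h \<in> {..<n} \<rightarrow> Units R \<Longrightarrow> \<exists>B\<subset>{..<n}. finprod R h B = finprod R h {..<n}"
  shows "\<exists>B\<subset>{..<n}. finprod R t B = finprod R t {..<n}"
proof -
  define E where "E j = finprod R t {..<j} [^] N" for j
  define drop where "drop j \<longleftrightarrow> E (Suc j) \<noteq> E j" for j
  define d where "d j = E j \<ominus> E (Suc j)" for j
  \<comment> \<open>For an idempotent \<open>d\<close>, the element \<open>1 - 2d\<close> is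
    \<open>-1\<close> on the component of \<open>d\<close> and \<open>1\<close> off it.\<close>
  define h where "h j = (if drop j then \<one> \<ominus> (d j \<oplus> d j) else E n \<otimes> t j \<oplus> (\<one> \<ominus> E n))" for j

  \<comment> \<open>The descending chain of idempotents\<close>
  have tcl [simp]: "t i \<in> carrier R" if "i < n" for i
    using t that by auto
  have pcl: "finprod R t {..<j} \<in> carrier R" if "j \<le> n" for j
    using that by (intro finprod_closed) auto
  have Ecl [simp]: "E j \<in> carrier R" if "j \<le> n" for j
    using pcl[OF that] by (simp add: E_def)
  have E0: "E 0 = \<one>"
    by (simp add: E_def)
  have ESuc: "E (Suc j) = E j \<otimes> t j [^] N" if "j < n" for j
    using that pcl[of j] by (simp add: E_def lessThan_Suc nat_pow_distrib m_comm Pi_def)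
  have idem: "x [^] N \<otimes> x [^] N = x [^] N" if x: "x \<in> carrier R" for x
  proof -
    obtain M where M: "N = Suc M"
      using N gr0_implies_Suc by blast
    have "x [^] N \<otimes> x [^] N = (x [^] N \<otimes> x) \<otimes> x [^] M"
      using x by (subst (2) M) (simp add: m_ac)
    also have "\<dots> = x [^] N"
      unfolding per[OF x] using x by (simp add: M m_comm)
    finally show ?thesis .
  qed
  have EE: "E i \<otimes> E j = E j" if "i \<le> j" "j \<le> n" for i j
    using that
  proof (induction j rule: dec_induct)
    case base
    then show ?case using idem[OF pcl[of i]] by (simp add: E_def)
  next
    case (step j)
    then show ?case by (simp add: ESuc m_assoc[symmetric])
  qed
  have EEn: "E n \<otimes> E j = E n" if "j \<le> n" for j
    using EE[OF that] that by (simp add: m_comm)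
  \<comment> \<open>The idempotent \<open>t j [^] N\<close> is a factor of \<open>E (Suc j)\<close>,
    which lies above \<open>E n\<close>. So \<open>t j\<close> is invertible on the component of
    \<open>E n\<close>.\<close>
  have Ent: "E n \<otimes> t j [^] N = E n" if "j < n" for j
  proof -
    have "E n \<otimes> t j [^] N = (E n \<otimes> E (Suc j)) \<otimes> t j [^] N"
      using EEn[of "Suc j"] that by simp
    also have "\<dots> = E n \<otimes> E j \<otimes> (t j [^] N \<otimes> t j [^] N)"
      using that by (simp add: ESuc m_ac)
    also have "\<dots> = E n \<otimes> E (Suc j)"
      using that by (simp add: idem ESuc m_assoc)
    finally show ?thesis
      using EEn[of "Suc j"] that by simp
  qed

  \<comment> \<open>Orthogonal differences of the chain\<close>
  have dcl [simp]: "d j \<in> carrier R" if "j < n" for j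
    using that by (simp add: d_def)
  \<comment> \<open>\<open>d j\<close> is the part of \<open>E j\<close> lost in passing to
    \<open>E (Suc j)\<close>: it lies below all earlier members of the chain and is orthogonal to
    all later ones.\<close>
  have dE_le: "d j \<otimes> E i = d j" if "i \<le> j" "j < n" for i j
    using that EE[of i j] EE[of i "Suc j"] by (simp add: d_def a_minus_def r_distr r_minus m_comm[of _ "E i"])
  have dE_gt: "d j \<otimes> E i = \<zero>" if "j < i" "i \<le> n" for i j
    using that EE[of j i] EE[of "Suc j" i] by (simp add: d_def a_minus_def l_distr l_minus r_neg)
  have dd: "d j \<otimes> d j = d j" if "j < n" for j
  proof -
    have "d j \<otimes> d j = d j \<otimes> E j \<ominus> d j \<otimes> E (Suc j)"
      using that by (subst (2) d_def) (simp add: a_minus_def r_distr r_minus)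
    then show ?thesis
      using that by (simp add: dE_le dE_gt a_minus_def)
  qed
  have d_orth: "d j \<otimes> d i = \<zero>" if "i \<noteq> j" "i < n" "j < n" for i j
  proof -
    have "d j \<otimes> d i = d j \<otimes> E i \<ominus> d j \<otimes> E (Suc i)"
      using that by (subst (2) d_def) (simp add: a_minus_def r_distr r_minus)
    also have "\<dots> = \<zero>"
      using that by (cases "i < j") (simp_all add: dE_le dE_gt a_minus_def r_neg)
    finally show ?thesis .
  qed

  \<comment> \<open>The replacing units\<close>
  have hU: "h j \<in> Units R" if j: "j < n" for j
  proof (cases "drop j")
    case True
    \<comment> \<open>The element \<open>1 - 2d\<close> is its own inverse, since
      \<open>4 d^2 = 4 d\<close>.\<close>
    have "(\<one> \<ominus> (d j \<oplus> d j)) \<otimes> (\<one> \<ominus> (d j \<oplus> d j))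
        = \<one> \<oplus> ((d j \<otimes> d j \<oplus> d j \<otimes> d j) \<oplus> (d j \<otimes> d j \<oplus> d j \<otimes> d j)) \<ominus> ((d j \<oplus> d j) \<oplus> (d j \<oplus> d j))"
      using dcl[OF j] by algebra
    also have "\<dots> = \<one>"
      using dcl[OF j] unfolding dd[OF j] by algebra
    finally have "(\<one> \<ominus> (d j \<oplus> d j)) \<otimes> (\<one> \<ominus> (d j \<oplus> d j)) = \<one>" .
    then show ?thesis
      using True j by (auto simp: h_def Units_def)
  next
    case False
    obtain M where M: "N = Suc M"
      using N gr0_implies_Suc by blast
    \<comment> \<open>On the component of \<open>E n\<close> the inverse of \<open>t j\<close> is
      its power with exponent \<open>N - 1\<close>; \<open>?y\<close> extends it by
      \<open>1\<close>.\<close>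
    let ?y = "E n \<otimes> t j [^] M \<oplus> (\<one> \<ominus> E n)"
    have cl: "E n \<in> carrier R" "t j \<in> carrier R" "t j [^] M \<in> carrier R"
      using j by auto
    have "E n \<otimes> (t j \<otimes> t j [^] M) = E n"
      using Ent[OF j] cl by (simp add: M m_comm)
    then have "(E n \<otimes> t j \<oplus> (\<one> \<ominus> E n)) \<otimes> ?y = \<one>"
      using cl EEn[OF order_refl] by (intro mult_idempotent_patch)
    then have "E n \<otimes> t j \<oplus> (\<one> \<ominus> E n) \<in> Units R"
      using cl unfolding Units_def by (auto intro!: bexI[of _ ?y] simp: m_comm)
    then show ?thesis
      using False by (simp add: h_def)
  qed
  have hcl: "h \<in> A \<rightarrow> carrier R" if "A \<subseteq> {..<n}" for A
    using that hU by (auto intro!: Units_closed)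

  \<comment> \<open>From the subsequence of units back to \<open>t\<close>\<close>
  obtain B where B: "B \<subset> {..<n}" and eq: "finprod R h B = finprod R h {..<n}"
    using units[of h] hU by blast
  have finB: "finite B"
    using B by (auto intro: finite_subset)
  define C where "C = {..<n} - B"
  have C: "finite C" "B \<inter> C = {}" "B \<union> C = {..<n}" "C \<subseteq> {..<n}"
    using B by (auto simp: C_def)
  have split: "finprod R s {..<n} = finprod R s B \<otimes> finprod R s C" if "s \<in> {..<n} \<rightarrow> carrier R" for s
    using finprod_Un_disjoint[of B C s] finB C that B by auto

  \<comment> \<open>On the component of \<open>d j\<close> only \<open>h j\<close> can differ from
    \<open>1\<close>: a sign change at \<open>i\<close> lives on the orthogonal \<open>d i\<close>,
    and the other replacements live on \<open>E n\<close>, orthogonal to \<open>d j\<close>.\<close>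
  have dh: "d j \<otimes> h i = d j" if "i \<noteq> j" "i < n" "j < n" for i j
  proof (cases "drop i")
    case True
    then have "d j \<otimes> h i = d j \<ominus> (d j \<otimes> d i \<oplus> d j \<otimes> d i)"
      using that by (simp add: h_def a_minus_def r_distr r_minus)
    then show ?thesis
      using that by (simp add: d_orth a_minus_def)
  next
    case False
    have cl: "E n \<in> carrier R" "t i \<in> carrier R" "d j \<in> carrier R"
      using that by auto
    have "d j \<otimes> h i = (d j \<otimes> E n) \<otimes> t i \<oplus> (d j \<ominus> d j \<otimes> E n)"
      unfolding h_def if_not_P[OF False] using cl by algebra
    also have "\<dots> = d j"
      unfolding dE_gt[OF \<open>j < n\<close> order_refl] using cl by algebra
    finally show ?thesis .
  qed

  \<comment> \<open>If \<open>j\<close> is omitted from \<open>B\<close>, multiplication by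
    \<open>d j\<close> turns the product over \<open>B\<close> into \<open>d j\<close> and the full
    product into \<open>- d j\<close>. Equality gives \<open>2 d j = 0\<close>, which
    \<open>two\<close> excludes when the chain drops at \<open>j\<close>.\<close>
  have nodrop: "\<not> drop j" if jC: "j \<in> C" for j
  proof
    assume drop: "drop j"
    have j: "j < n" "j \<notin> B"
      using jC by (auto simp: C_def)
    have "d j \<otimes> h i = d j" if "i \<in> B" for i
      using that B j by (intro dh) auto
    then have "d j \<otimes> finprod R h B = d j"
      using finB hcl[of B] B j by (intro finprod_mult_absorb) auto
    moreover have "d j \<otimes> finprod R h {..<n} = \<ominus> d j"
    proof -
      have "finprod R h {..<n} = h j \<otimes> finprod R h ({..<n} - {j})"
        using j hcl[of "{..<n}"] finprod_insert[of "{..<n} - {j}" j h] by (auto simp: insert_absorb)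
      moreover have "d j \<otimes> finprod R h ({..<n} - {j}) = d j"
        using hcl[of "{..<n} - {j}"] j dh by (intro finprod_mult_absorb) auto
      moreover have "finprod R h ({..<n} - {j}) \<in> carrier R"
        using hcl[of "{..<n} - {j}"] by auto
      moreover have "h j \<in> carrier R"
        using hU[OF j(1)] by (rule Units_closed)
      ultimately have "d j \<otimes> finprod R h {..<n} = h j \<otimes> d j"
        using j by (simp add: m_lcomm[of "d j" "h j"])
      also have "\<dots> = d j \<ominus> (d j \<otimes> d j \<oplus> d j \<otimes> d j)"
        unfolding h_def if_P[OF drop] using dcl[OF j(1)] by algebra
      also have "\<dots> = \<ominus> d j"
        unfolding dd[OF j(1)] using dcl[OF j(1)] by algebra
      finally show ?thesis .
    qed
    ultimately have "d j = \<ominus> d j"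
      using eq by simp
    then have "d j \<oplus> d j = \<zero>"
      using dcl[OF j(1)] by (metis r_neg)
    then have "d j = \<zero>"
      using dcl[OF j(1)] by (rule two[rotated])
    then show False
      using drop j by (simp add: drop_def d_def)
  qed

  \<comment> \<open>The product over \<open>B\<close> is a unit and cancels, leaving product
    \<open>1\<close> over the deleted indices \<open>C\<close>.\<close>
  have "finprod R h B \<in> Units R"
    using finB B hU by (intro finprod_Units) auto
  moreover have "finprod R h C \<in> carrier R"
    using hcl[of C] C by auto
  ultimately have hC: "finprod R h C = \<one>"
    using eq split[of h] hcl[of "{..<n}"]
    by (metis Units_closed Units_l_cancel one_closed order_refl r_one)
  \<comment> \<open>No index in \<open>C\<close> is a drop, so there \<open>h i\<close> agrees with
    \<open>t i\<close> on the component of \<open>E n\<close>.\<close>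
  have "E n \<otimes> finprod R t C = E n \<otimes> finprod R h C"
  proof (rule finprod_mult_cong)
    fix i assume i: "i \<in> C"
    then have cl: "E n \<in> carrier R" "t i \<in> carrier R"
      using C by auto
    have "E n \<otimes> h i = (E n \<otimes> E n) \<otimes> t i \<oplus> (E n \<ominus> E n \<otimes> E n)"
      unfolding h_def if_not_P[OF nodrop[OF i]] using cl by algebra
    also have "\<dots> = E n \<otimes> t i"
      unfolding EEn[OF order_refl] using cl by algebra
    finally show "E n \<otimes> t i = E n \<otimes> h i" by simp
  qed (use C hcl[of C] t in auto)
  then have EC: "E n \<otimes> finprod R t C = E n"
    by (simp add: hC)

  have Bcl: "finprod R t (B \<inter> {..<m}) \<in> carrier R" for m
    using B t by (intro finprod_closed) auto
  \<comment> \<open>Indices outside \<open>B\<close> leave the chain unchanged, so the idempotents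
    of the prefix products within \<open>B\<close> follow the same chain. At \<open>m = n\<close>,
    the product over \<open>B\<close> has support \<open>E n\<close>.\<close>
  have "finprod R t (B \<inter> {..<m}) [^] N = E m" if "m \<le> n" for m
    using that
  proof (induction m)
    case 0
    then show ?case by (simp add: E0)
  next
    case (Suc m)
    show ?case
    proof (cases "m \<in> B")
      case True
      then have "B \<inter> {..<Suc m} = insert m (B \<inter> {..<m})" by auto
      then have "finprod R t (B \<inter> {..<Suc m}) = t m \<otimes> finprod R t (B \<inter> {..<m})"
        using Suc t B by (simp add: Pi_def)
      then show ?thesis
        using Suc Bcl[of m] by (simp add: nat_pow_distrib ESuc m_comm)
    next
      case False
      then have "B \<inter> {..<Suc m} = B \<inter> {..<m}"
        by (auto simp: less_Suc_eq)
      moreover have "\<not> drop m"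
        using False Suc by (intro nodrop) (auto simp: C_def)
      ultimately show ?thesis
        using Suc by (simp add: drop_def)
    qed
  qed
  from this[of n] have EB: "finprod R t B [^] N = E n"
    using B by (simp add: Int_absorb2)
  have cl: "finprod R t B \<in> carrier R" "finprod R t C \<in> carrier R"
    using B C t by (auto intro!: finprod_closed)
  \<comment> \<open>The product over \<open>B\<close> absorbs \<open>E n\<close>, and
    \<open>E n\<close> absorbs the product over \<open>C\<close>.\<close>
  have "finprod R t {..<n} = finprod R t B \<otimes> finprod R t C"
    using t by (rule split)
  also have "\<dots> = (E n \<otimes> finprod R t B) \<otimes> finprod R t C"
    using per[OF cl(1)] by (simp add: EB)
  also have "\<dots> = finprod R t B \<otimes> (E n \<otimes> finprod R t C)"
    using cl by (simp add: m_ac)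
  also have "\<dots> = E n \<otimes> finprod R t B"
    using cl by (simp add: EC m_comm)
  also have "\<dots> = finprod R t B"
    using per[OF cl(1)] by (simp add: EB)
  finally show ?thesis
    using B by auto
qed

lemma davenport_eq_davenport_units_of:
  assumes fin: "finite (carrier R)"
    and reduced: "\<And>x n. x \<in> carrier R \<Longrightarrow> x [^] (n::nat) = \<zero> \<Longrightarrow> x = \<zero>"
    and two: "\<And>x. x \<in> carrier R \<Longrightarrow> x \<oplus> x = \<zero> \<Longrightarrow> x = \<zero>"
  shows "davenport R = davenport (units_of R)"
proof (rule antisym)
  have U: "comm_monoid (units_of R)" "finite (carrier (units_of R))"
    using units_comm_group fin
    by (auto simp: units_of_carrier Units_def intro: comm_group.axioms(1) finite_subset)
  have "\<exists>N::nat. 0 < N \<and> (\<forall>x\<in>carrier R. x [^] N \<otimes> x = x)"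
    using fin reduced by (rule finite_reduced_uniform_exponent)
  then obtain N :: nat where N: "0 < N" and per: "\<And>x. x \<in> carrier R \<Longrightarrow> x [^] N \<otimes> x = x"
    by blast
  show "davenport R \<le> davenport (units_of R)"
  proof (rule davenport_le)
    show "0 < davenport (units_of R)"
      using U by (rule comm_monoid.davenport_property)
  next
    fix T assume T: "set_mset T \<subseteq> carrier R" "davenport (units_of R) \<le> size T"
    let ?A = "{..<size T}"
    obtain t where t: "T = image_mset t (mset_set ?A)"
      by (rule mset_eq_image_mset_upto)
    have "set_mset T = t ` ?A"
      by (subst t) simp
    then have tc: "t \<in> ?A \<rightarrow> carrier R"
      using T by auto
    \<comment> \<open>A family of units on \<open>?A\<close> has the length of \<open>T\<close>, so
      the bound for the unit group applies to it.\<close>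
    have "\<exists>B\<subset>?A. finprod R h B = finprod R h ?A" if h: "h \<in> ?A \<rightarrow> Units R" for h
    proof -
      let ?H = "image_mset h (mset_set ?A)"
      have H: "set_mset ?H \<subseteq> Units R"
        using h by auto
      then have "reducible_seq (units_of R) ?H"
        using T by (intro comm_monoid.davenport_property(2)[OF U]) (auto simp: units_of_carrier)
      then have "reducible_seq R ?H"
        using H by (simp add: reducible_seq_units_of_iff)
      then show ?thesis
        using h by (subst (asm) reducible_seq_image_mset_iff) (auto simp: Pi_def Units_closed)
    qed
    with N per two tc have "\<exists>B\<subset>?A. finprod R t B = finprod R t ?A"
      by (rule reducible_of_units_reducible)
    then have "reducible_seq R (image_mset t (mset_set ?A))"
      using tc by (subst reducible_seq_image_mset_iff) auto
    then show "reducible_seq R T"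
      using t by simp
  qed
  show "davenport (units_of R) \<le> davenport R"
    using fin by (rule davenport_units_of_le)
qed

end

subsection \<open>Squarefree quotients of polynomial rings\<close>

context cring
begin

lemma prime_divides_finprod:
  assumes p: "p \<in> carrier R" "Divisibility.prime R p"
    and "finite A" and "t \<in> A \<rightarrow> carrier R" and "p divides finprod R t A"
  shows "\<exists>i\<in>A. p divides t i"
  using assms(3-)
proof (induction A rule: finite_induct)
  case empty
  then obtain c where "c \<in> carrier R" "\<one> = p \<otimes> c"
    by (auto simp: factor_def)
  then have "p \<in> Units R"
    using p by (auto simp: Units_def m_comm)
  then show ?case
    using p by (auto elim: primeE)
next
  case (insert x A)
  then have "p divides t x \<otimes> finprod R t A"
    by (simp add: Pi_def)
  moreover have "t x \<in> carrier R" "finprod R t A \<in> carrier R"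
    using insert by auto
  ultimately have "p divides t x \<or> p divides finprod R t A"
    using p(2) unfolding Divisibility.prime_def by blast
  then show ?case
    using insert by auto
qed

lemma prime_divides_nat_pow:
  assumes p: "p \<in> carrier R" "Divisibility.prime R p"
    and a: "a \<in> carrier R" and "p divides a [^] (n::nat)"
  shows "p divides a"
  using prime_divides_finprod[OF p, of "{..<n}" "\<lambda>_. a"] assms by (auto simp: finprod_const)

end

section \<open>Products of pairwise non-associated irreducibles\<close>

context principal_domain
begin

lemma finprod_nonzero:
  assumes "finite A" and "g \<in> A \<rightarrow> carrier R" and "\<And>i. i \<in> A \<Longrightarrow> g i \<noteq> \<zero>"
  shows "finprod R g A \<noteq> \<zero>"
  using assms
proof (induction A rule: finite_induct)
  case (insert x A)
  then have "g x \<in> carrier R" "g \<in> A \<rightarrow> carrier R"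
    by auto
  with insert show ?case
    by (auto simp: integral_iff)
qed simp

lemma ring_irreducible_imp_prime:
  assumes "q \<in> carrier R" "ring_irreducible q"
  shows "Divisibility.prime R q"
  using assms primeness_condition ring_primeE(3) by blast

text \<open>In \<open>r = q c\<close> one factor is a unit because \<open>r\<close> is irreducible,
  and \<open>q\<close> is not a unit.\<close>

lemma ring_irreducible_divides_imp_associated:
  assumes "q \<in> carrier R" "ring_irreducible q" "r \<in> carrier R" "ring_irreducible r" "q divides r"
  shows "q \<sim> r"
proof -
  obtain c where c: "c \<in> carrier R" "r = q \<otimes> c"
    using assms(5) by (auto simp: factor_def)
  then have "c \<in> Units R"
    using ring_irreducibleE(5)[OF assms(3,4,1) c] ring_irreducibleE(4)[OF assms(1,2)] by blast
  then have "q = r \<otimes> inv c" "inv c \<in> carrier R"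
    using c assms(1) by (simp_all add: m_assoc)
  then have "r divides q"
    by (auto simp: factor_def)
  with assms(5) show ?thesis
    by (simp add: associated_def)
qed

text \<open>Write \<open>a\<close> as the product so far times a cofactor \<open>c\<close>. The next
  prime divides \<open>a\<close> but not that product, else it would be associated to one of its
  factors; so it divides \<open>c\<close>.\<close>

lemma finprod_irreducibles_divides:
  assumes "finite A" and "\<And>i. i \<in> A \<Longrightarrow> g i \<in> carrier R"
    and "\<And>i. i \<in> A \<Longrightarrow> ring_irreducible (g i)"
    and "\<And>i j. i \<in> A \<Longrightarrow> j \<in> A \<Longrightarrow> i \<noteq> j \<Longrightarrow> \<not> g i \<sim> g j"
    and a: "a \<in> carrier R" and "\<And>i. i \<in> A \<Longrightarrow> g i divides a"
  shows "finprod R g A divides a"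
  using assms(1-4,6)
proof (induction A rule: finite_induct)
  case empty
  then show ?case using a by (simp add: one_divides)
next
  case (insert x A)
  have cl: "g x \<in> carrier R" "g \<in> A \<rightarrow> carrier R"
    using insert.prems by auto
  have prime: "Divisibility.prime R (g x)"
    using insert.prems cl by (intro ring_irreducible_imp_prime) auto
  have "finprod R g A divides a"
    using insert by auto
  then obtain c where c: "c \<in> carrier R" "a = finprod R g A \<otimes> c"
    by (auto simp: factor_def)
  have "\<not> g x divides finprod R g A"
  proof
    assume "g x divides finprod R g A"
    then obtain i where i: "i \<in> A" "g x divides g i"
      using prime_divides_finprod[OF cl(1) prime insert(1) cl(2)] by blast
    then have "g x \<sim> g i"
      using insert.prems by (intro ring_irreducible_divides_imp_associated) auto
    then show False
      using i insert by (metis insertCI)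
  qed
  moreover have "g x divides finprod R g A \<otimes> c"
    using insert.prems c by auto
  ultimately have "g x divides c"
    using prime c cl by (auto elim!: primeE)
  then obtain c' where c': "c' \<in> carrier R" "c = g x \<otimes> c'"
    by (auto simp: factor_def)
  then have "a = finprod R g (insert x A) \<otimes> c'"
    using c cl insert by (simp add: m_ac)
  then show ?case
    using c' by (auto simp: factor_def)
qed

text \<open>The ideal generated by the product is radical: each prime factor of \<open>a^n\<close>
  already divides \<open>a\<close>, and the non-associated primes combine.\<close>

lemma finprod_irreducibles_squarefree:
  assumes A: "finite A" and g: "\<And>i. i \<in> A \<Longrightarrow> g i \<in> carrier R"
    and irr: "\<And>i. i \<in> A \<Longrightarrow> ring_irreducible (g i)"
    and nonassoc: "\<And>i j. i \<in> A \<Longrightarrow> j \<in> A \<Longrightarrow> i \<noteq> j \<Longrightarrow> \<not> g i \<sim> g j"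
    and a: "a \<in> carrier R" and dvd: "finprod R g A divides a [^] (n::nat)"
  shows "finprod R g A divides a"
proof (rule finprod_irreducibles_divides[OF A g irr nonassoc a])
  fix i assume i: "i \<in> A"
  have cl: "finprod R g (A - {i}) \<in> carrier R"
    using g by (intro finprod_closed) auto
  have "finprod R g A = g i \<otimes> finprod R g (A - {i})"
    using finprod_insert[of "A - {i}" i g] A g i by (auto simp: insert_absorb)
  then have "g i divides finprod R g A"
    using cl by (auto simp: factor_def)
  then have "g i divides a [^] n"
    using dvd g[OF i] by (rule divides_trans)
  then show "g i divides a"
    using i g irr a by (intro prime_divides_nat_pow[of "g i" a n] ring_irreducible_imp_prime)
qed

end

text \<open>A class vanishes exactly when \<open>f\<close> divides a representative, so nilpotence
  in the quotient becomes the divisibility in \<open>radical\<close>.\<close>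

lemma (in cring) FactRing_PIdl_reduced:
  assumes f: "f \<in> carrier R"
    and radical: "\<And>a n. a \<in> carrier R \<Longrightarrow> f divides a [^] (n::nat) \<Longrightarrow> f divides a"
    and x: "x \<in> carrier (R Quot PIdl f)" "x [^]\<^bsub>R Quot PIdl f\<^esub> (n::nat) = \<zero>\<^bsub>R Quot PIdl f\<^esub>"
  shows "x = \<zero>\<^bsub>R Quot PIdl f\<^esub>"
proof -
  have mem: "b \<in> PIdl f \<longleftrightarrow> f divides b" if "b \<in> carrier R" for b
    unfolding cgenideal_def factor_def using f m_comm by fastforce
  obtain a where a: "a \<in> carrier R" "x = PIdl f +> a"
    using x(1) unfolding FactRing_def A_RCOSETS_def' by auto
  have zero: "\<zero>\<^bsub>R Quot PIdl f\<^esub> = PIdl f"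
    by (simp add: FactRing_def)
  have I: "ideal (PIdl f) R"
    using f by (rule cgenideal_ideal)
  have "PIdl f +> (a [^] n) = PIdl f"
    using x(2) ring_hom_ring.hom_nat_pow[OF ideal.rcos_ring_hom_ring[OF I] a(1), of n]
    unfolding a(2) zero by (rule trans[rotated])
  then have "a [^] n \<in> PIdl f"
    using a by (intro ideal.rcos_const_imp_mem[OF I]) auto
  then have "f divides a"
    using mem radical a by blast
  then have "a \<in> PIdl f"
    using mem a by blast
  then show ?thesis
    unfolding a(2) zero by (rule a_rcos_zero[OF I])
qed

text \<open>The image of \<open>1/2\<close> inverts \<open>2\<close> in \<open>S\<close>;
  multiplying \<open>2x = 0\<close> by it gives \<open>x = 0\<close>.\<close>

lemma (in ring) ring_hom_double_eq_zero:
  assumes h: "h \<in> ring_hom R S" and S: "ring S" and unit: "\<one> \<oplus> \<one> \<in> Units R"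
    and x: "x \<in> carrier S" "x \<oplus>\<^bsub>S\<^esub> x = \<zero>\<^bsub>S\<^esub>"
  shows "x = \<zero>\<^bsub>S\<^esub>"
proof -
  interpret S: ring S by (rule S)
  let ?w = "h (inv (\<one> \<oplus> \<one>))"
  have w: "?w \<in> carrier S"
    using h unit by (auto intro: ring_hom_closed)
  have "?w \<otimes>\<^bsub>S\<^esub> (\<one>\<^bsub>S\<^esub> \<oplus>\<^bsub>S\<^esub> \<one>\<^bsub>S\<^esub>) = h (inv (\<one> \<oplus> \<one>) \<otimes> (\<one> \<oplus> \<one>))"
    using unit
    by (simp add: ring_hom_mult[OF h] ring_hom_add[OF h one_closed one_closed] ring_hom_one[OF h] del: Units_l_inv)
  also have "\<dots> = \<one>\<^bsub>S\<^esub>"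
    using unit ring_hom_one[OF h] by simp
  finally have "x = (?w \<otimes>\<^bsub>S\<^esub> (\<one>\<^bsub>S\<^esub> \<oplus>\<^bsub>S\<^esub> \<one>\<^bsub>S\<^esub>)) \<otimes>\<^bsub>S\<^esub> x"
    using x by simp
  also have "\<dots> = ?w \<otimes>\<^bsub>S\<^esub> (x \<oplus>\<^bsub>S\<^esub> x)"
    using w x(1) by (simp add: S.m_assoc S.l_distr)
  also have "\<dots> = \<zero>\<^bsub>S\<^esub>"
    using w by (simp add: x(2))
  finally show ?thesis .
qed

text \<open>Remainders modulo \<open>f\<close> represent all classes, and they are coefficient lists
  of bounded length over a finite field.\<close>

lemma (in field) finite_carrier_Rupt:
  assumes fin: "finite (carrier R)" and f: "f \<in> carrier (poly_ring R)" "f \<noteq> []"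
  shows "finite (carrier (Rupt (carrier R) f))"
proof -
  have "(\<lambda>q. q pmod f) ` carrier (poly_ring R) \<subseteq> {xs. set xs \<subseteq> carrier R \<and> length xs \<le> length f}"
  proof clarify
    fix q assume q: "q \<in> carrier (poly_ring R)"
    then have "q pmod f \<in> carrier (poly_ring R)"
      using f by (intro long_division_closed[OF carrier_is_subfield])
    moreover have "q pmod f = [] \<or> degree (q pmod f) < degree f"
      using q f by (intro pmod_degree[OF carrier_is_subfield])
    ultimately show "set (q pmod f) \<subseteq> carrier R \<and> length (q pmod f) \<le> length f"
      by (auto simp: univ_poly_def polynomial_def)
  qed
  then have "finite ((\<lambda>q. q pmod f) ` carrier (poly_ring R))"
    using finite_lists_length_le[OF fin] by (rule finite_subset)
  then show ?thesis
    unfolding rupture_carrier_as_pmod_image[OF carrier_is_subfield f(1), symmetric] by (rule finite_imageI)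
qed

theorem theorem1p1:
  fixes p k :: nat and f :: "int list" and g :: "nat \<Rightarrow> int list"
  assumes "Factorial_Ring.prime p" and "2 < p"
    and "1 \<le> k"
    and "f \<in> carrier (Fp_poly p)"
    and "\<And>i. i \<in> {1..k} \<Longrightarrow> g i \<in> carrier (Fp_poly p)"
    and "\<And>i. i \<in> {1..k} \<Longrightarrow> ring_irreducible\<^bsub>Fp_poly p\<^esub> (g i)"
    and "\<And>i j. i \<in> {1..k} \<Longrightarrow> j \<in> {1..k} \<Longrightarrow> i \<noteq> j \<Longrightarrow> \<not> g i \<sim>\<^bsub>Fp_poly p\<^esub> g j"
    and "f = (\<Otimes>\<^bsub>Fp_poly p\<^esub>i\<in>{1..k}. g i)"
  shows "davenport (poly_semigroup p f) = davenport (units_of (poly_semigroup p f))"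
proof -
  interpret F: residues_prime p "residue_ring (int p)"
    using assms(1) by (rule residues_prime.intro)
  let ?K = "carrier (residue_ring (int p))"
  have K: "subfield ?K (residue_ring (int p))" "subring ?K (residue_ring (int p))"
    by (rule F.carrier_is_subfield F.carrier_is_subring)+
  interpret P: principal_domain "Fp_poly p"
    using K(1) by (rule F.univ_poly_is_principal)
  let ?Q = "poly_semigroup p f"
  \<comment> \<open>The rupture ring of \<open>f\<close> is by definition this quotient; it brings
    representation by remainders and the map from constants.\<close>
  have Rupt: "?Q = Rupt\<^bsub>residue_ring (int p)\<^esub> ?K f"
    by (simp add: poly_semigroup_def rupture_def)
  have cring: "cring ?Q"
    unfolding poly_semigroup_def
    using ideal.quotient_is_cring[OF P.cgenideal_ideal[OF assms(4)]] P.is_cring by blast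
  \<comment> \<open>Irreducibility includes being nonzero, which makes \<open>f\<close> nonzero and
    division by \<open>f\<close> possible.\<close>
  have "\<And>i. i \<in> {1..k} \<Longrightarrow> g i \<noteq> \<zero>\<^bsub>Fp_poly p\<^esub>"
    using assms(6) by (simp add: ring_irreducible_def)
  then have "f \<noteq> \<zero>\<^bsub>Fp_poly p\<^esub>"
    unfolding assms(8) using assms(5) by (intro P.finprod_nonzero) auto
  then have "finite (carrier ?Q)"
    unfolding Rupt using assms(4) by (intro F.finite_carrier_Rupt) (auto simp: univ_poly_zero F.finite)
  moreover have "x = \<zero>\<^bsub>?Q\<^esub>"
    if "x \<in> carrier ?Q" "x [^]\<^bsub>?Q\<^esub> n = \<zero>\<^bsub>?Q\<^esub>" for x and n :: nat
  proof -
    have "f divides\<^bsub>Fp_poly p\<^esub> a"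
      if "a \<in> carrier (Fp_poly p)" "f divides\<^bsub>Fp_poly p\<^esub> a [^]\<^bsub>Fp_poly p\<^esub> m" for a and m :: nat
      using finite_atLeastAtMost assms(5-7) that unfolding assms(8)
      by (rule P.finprod_irreducibles_squarefree)
    with assms(4) show ?thesis
      using that unfolding poly_semigroup_def by (rule P.FactRing_PIdl_reduced)
  qed
  moreover have "x = \<zero>\<^bsub>?Q\<^esub>" if "x \<in> carrier ?Q" "x \<oplus>\<^bsub>?Q\<^esub> x = \<zero>\<^bsub>?Q\<^esub>" for x
  proof (rule F.ring_hom_double_eq_zero[OF _ _ _ that])
    \<comment> \<open>The prime field maps to the quotient through constant polynomials.\<close>
    show "F.rupture_surj ?K f \<circ> F.poly_of_const \<in> ring_hom (residue_ring (int p)) ?Q"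
      using F.rupture_surj_norm_is_hom[OF K(2) assms(4)] by (simp add: Rupt)
    show "ring ?Q"
      using cring by (rule cring.axioms)
    \<comment> \<open>Since \<open>2 < p\<close>, the sum \<open>1 + 1\<close> is not reduced to
      zero modulo \<open>p\<close>.\<close>
    show "\<one>\<^bsub>residue_ring (int p)\<^esub> \<oplus>\<^bsub>residue_ring (int p)\<^esub> \<one>\<^bsub>residue_ring (int p)\<^esub>
        \<in> Units (residue_ring (int p))"
      using assms(2) by (subst F.field_Units) (auto simp: residue_ring_def)
  qed
  ultimately show ?thesis
    by (rule cring.davenport_eq_davenport_units_of[OF cring])
qed

end
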